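(* Let $M\ge4$ be an even integer, let $\chi\in(0,1]$, $\Pr>0$, and let $\bar\sigma_{12}\in\mathbb{R}$ and $\bar u_1^W\in\mathbb{R}$ be given constants. With the matrices and vectors defined in the context, the linear system $$\bar\sigma_{12}\,r+E\begin{bmatrix}0& \\ &M_0\end{bmatrix}\begin{bmatrix}\bar u_1(0)-\bar u_1^W \\ R_{\rm odd}\,\hat v_+(0)\end{bmatrix}=b(\chi)\,E\,\tilde S\begin{bmatrix}\bar u_1(0)-\bar u_1^W \\ R_{\rm even}\,\hat v_+(0)\end{bmatrix}$$ has a unique solution $(\bar u_1(0),\hat v_+(0))\in\mathbb{R}\times\mathbb{R}^{m_o}$.
   Context: This is the wall boundary system of the $M$-th order reduced moment system for Kramers' problem. Put $m_e=\lfloor\frac{M-1}2\rfloor$, $m_o=\lfloor\frac{M-2}2\rfloor$. $\mathrm{He}_n$ is the probabilists' Hermite polynomial, $\mathrm{He}_\alpha(\xi)=\prod_{i=1}^3\mathrm{He}_{\alpha_i}(\xi_i)$ for $\alpha\in\mathbb{N}^3$, $e_1,e_2,e_3$ is the standard basis, $\bar\omega(\xi)=(2\pi)^{-3/2}e^{-|\xi|^2/2}$ on $\mathbb{R}^3$, $\langle p,q\rangle_{\bar\omega}=\int_{\mathbb{R}^3}pq\,\bar\omega\,d\xi$. $\phi_i=\mathrm{He}_{e_1+2ie_2}$ for $1\le i\le m_e$, $\varphi_j=\mathrm{He}_{e_1+(2j+1)e_2}$ for $1\le j\le m_o$; $a_i=\sqrt{\big(1-\frac{1-\Pr}5\delta_{i,1}\big)\langle\phi_i,\phi_i\rangle_{\bar\omega}}$,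 $b_j=\sqrt{\langle\varphi_j,\varphi_j\rangle_{\bar\omega}}$; $L_1=\mathrm{diag}(a_i)_{i=1}^{m_e}$; $M_0\in\mathbb{R}^{m_e\times m_o}$ has entries $\frac1{a_ib_j}\langle\phi_i,\xi_2\varphi_j\rangle_{\bar\omega}$. The symmetric matrix $\mathbf M=\begin{bmatrix}0&M_0 \\ M_0^T&0\end{bmatrix}$ has an orthogonal diagonalization $\mathbf M R=R\Lambda$ with $R=\begin{bmatrix}R_{\rm even}&R_0&R_{\rm even} \\ R_{\rm odd}&0&-R_{\rm odd}\end{bmatrix}$ orthogonal, $R_{\rm even}\in\mathbb{R}^{m_e\times m_o}$, $R_{\rm odd}\in\mathbb{R}^{m_o\times m_o}$, $R_0\in\mathbb{R}^{m_e\times(m_e-m_o)}$, $\Lambda=\mathrm{diag}(\Lambda_+,0_{m_e-m_o},-\Lambda_+)$, $\Lambda_+$ diagonal with positive entries in nonincreasing order; such a diagonalization is fixed. $S(\alpha,\beta)=\int_{-\infty}^0\xi\,\mathrm{He}_\alpha(\xi)\mathrm{He}_\beta(\xi)e^{-\xi^2/2}d\xi$. $\mathbf S=(s_{ij})\in\mathbb{R}^{(m_e+1)\times(m_e+1)}$ with $s_{ij}=S(2i-2,2j-2)$, and $\tilde S=\mathrm{diag}(1,L_1)^{-1}\,\mathbf S\,\mathrm{diag}(1,L_1)^{-1}$. $E=[I_{m_o+1},0]\in\mathbb{R}^{(m_o+1)\times(m_e+1)}$ (the identity for even $M$); $\begin{bmatrix}0& \\ &M_0\end{bmatrix}$ is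 block diagonal of size $(m_e+1)\times(m_o+1)$. $r=(1,2/a_1,0,\dots,0)^T\in\mathbb{R}^{m_o+1}$. $b(\chi)=\frac{2\chi}{2-\chi}(2\pi)^{-1/2}$. *)

theory Defs
  imports
    "HOL-Analysis.Analysis"
    "HOL-Computational_Algebra.Polynomial"
    "Jordan_Normal_Form.Gauss_Jordan_Elimination"
begin

text \<open>
  Block sizes depend on \<open>M\<close>, so matrices and vectors are those of \<open>Jordan_Normal_Form\<close>, with
  explicit dimensions and indices starting at 0. The scalar families \<open>phi_even\<close>, \<open>phi_odd\<close>,
  \<open>a_coef\<close>, \<open>b_coef\<close> are indexed from 1, hence the \<open>Suc\<close> in matrix entries.
  Components of \<open>\<xi> :: real^3\<close> are written with \<open>vec_nth\<close> because \<open>$\<close> is also matrix-library syntax.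
\<close>

definition m_e :: "nat \<Rightarrow> nat" where
  "m_e M = (M - 1) div 2"

definition m_o :: "nat \<Rightarrow> nat" where
  "m_o M = (M - 2) div 2"


text \<open>Probabilists' (monic) normalization: \<open>He\<^sub>2 = x\<^sup>2 - 1\<close>.\<close>

fun He :: "nat \<Rightarrow> real poly" where
  "He 0 = 1"
| "He (Suc 0) = [:0, 1:]"
| "He (Suc (Suc n)) = [:0, 1:] * He (Suc n) - Polynomial.smult (real (Suc n)) (He n)"

definition He_multi :: "nat^3 \<Rightarrow> real^3 \<Rightarrow> real" where
  "He_multi \<alpha> \<xi> = (\<Prod>i\<in>UNIV. poly (He (vec_nth \<alpha> i)) (vec_nth \<xi> i))"

definition omega_bar :: "real^3 \<Rightarrow> real" where
  "omega_bar \<xi> = (2 * pi) powr (- 3 / 2) * exp (- (norm \<xi>)\<^sup>2 / 2)"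

definition inner_omega :: "(real^3 \<Rightarrow> real) \<Rightarrow> (real^3 \<Rightarrow> real) \<Rightarrow> real" where
  "inner_omega p q = (LINT \<xi>|lborel. p \<xi> * q \<xi> * omega_bar \<xi>)"

definition phi_even :: "nat \<Rightarrow> real^3 \<Rightarrow> real" where
  "phi_even i = He_multi (axis 1 1 + axis 2 (2 * i))"

definition phi_odd :: "nat \<Rightarrow> real^3 \<Rightarrow> real" where
  "phi_odd j = He_multi (axis 1 1 + axis 2 (2 * j + 1))"

definition a_coef :: "real \<Rightarrow> nat \<Rightarrow> real" where
  "a_coef Pr i =
     sqrt ((1 - (1 - Pr) / 5 * (if i = 1 then 1 else 0)) * inner_omega (phi_even i) (phi_even i))"

definition b_coef :: "nat \<Rightarrow> real" where
  "b_coef j = sqrt (inner_omega (phi_odd j) (phi_odd j))"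

definition L1 :: "nat \<Rightarrow> real \<Rightarrow> real mat" where
  "L1 M Pr = mat_diag (m_e M) (\<lambda>i. a_coef Pr (Suc i))"

definition M0 :: "nat \<Rightarrow> real \<Rightarrow> real mat" where
  "M0 M Pr = mat (m_e M) (m_o M) (\<lambda>(i, j).
     1 / (a_coef Pr (Suc i) * b_coef (Suc j)) *
     inner_omega (phi_even (Suc i)) (\<lambda>\<xi>. vec_nth \<xi> 2 * phi_odd (Suc j) \<xi>))"

definition M_sym :: "nat \<Rightarrow> real \<Rightarrow> real mat" where
  "M_sym M Pr = four_block_mat
     (0\<^sub>m (m_e M) (m_e M)) (M0 M Pr)
     (transpose_mat (M0 M Pr)) (0\<^sub>m (m_o M) (m_o M))"

definition append_cols :: "real mat \<Rightarrow> real mat \<Rightarrow> real mat" where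
  "append_cols A B = four_block_mat A B (0\<^sub>m 0 (dim_col A)) (0\<^sub>m 0 (dim_col B))"

definition R_block :: "nat \<Rightarrow> real mat \<Rightarrow> real mat \<Rightarrow> real mat \<Rightarrow> real mat" where
  "R_block M R_even R_zero R_odd = four_block_mat
     R_even (append_cols R_zero R_even)
     R_odd  (append_cols (0\<^sub>m (m_o M) (m_e M - m_o M)) (- R_odd))"

definition Lambda_block :: "nat \<Rightarrow> real mat \<Rightarrow> real mat" where
  "Lambda_block M Lp =
     diag_block_mat [Lp, 0\<^sub>m (m_e M - m_o M) (m_e M - m_o M), - Lp]"

text \<open>
  Orthogonality of \<open>R\<close> is \<open>R\<^sup>T R = 1\<close>; the constant \<open>orthogonal_mat\<close> of \<open>Jordan_Normal_Form\<close> only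
  asks for pairwise orthogonal nonzero columns.
\<close>

definition diagonalization ::
  "nat \<Rightarrow> real \<Rightarrow> real mat \<Rightarrow> real mat \<Rightarrow> real mat \<Rightarrow> real mat \<Rightarrow> bool" where
  "diagonalization M Pr R_even R_zero R_odd Lp \<longleftrightarrow>
     R_even \<in> carrier_mat (m_e M) (m_o M) \<and>
     R_zero \<in> carrier_mat (m_e M) (m_e M - m_o M) \<and>
     R_odd \<in> carrier_mat (m_o M) (m_o M) \<and>
     Lp \<in> carrier_mat (m_o M) (m_o M) \<and>
     diagonal_mat Lp \<and>
     (\<forall>i < m_o M. 0 < Lp $$ (i, i)) \<and>
     (\<forall>i j. i \<le> j \<and> j < m_o M \<longrightarrow> Lp $$ (j, j) \<le> Lp $$ (i, i)) \<and>
     (let R = R_block M R_even R_zero R_odd in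
        transpose_mat R * R = 1\<^sub>m (m_e M + m_o M) \<and>
        M_sym M Pr * R = R * Lambda_block M Lp)"

definition S_half :: "nat \<Rightarrow> nat \<Rightarrow> real" where
  "S_half \<alpha> \<beta> = (LBINT \<xi>:{..0}. \<xi> * poly (He \<alpha>) \<xi> * poly (He \<beta>) \<xi> * exp (- \<xi>\<^sup>2 / 2))"

definition S_mat :: "nat \<Rightarrow> real mat" where
  "S_mat M = mat (m_e M + 1) (m_e M + 1) (\<lambda>(i, j). S_half (2 * i) (2 * j))"

definition S_tilde :: "nat \<Rightarrow> real \<Rightarrow> real mat" where
  "S_tilde M Pr =
     (let D_inv = the (mat_inverse (diag_block_mat [1\<^sub>m 1, L1 M Pr]))
      in D_inv * S_mat M * D_inv)"

definition E_mat :: "nat \<Rightarrow> real mat" where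
  "E_mat M = mat (m_o M + 1) (m_e M + 1) (\<lambda>(i, j). if i = j then 1 else 0)"

definition r_vec :: "nat \<Rightarrow> real \<Rightarrow> real vec" where
  "r_vec M Pr = vec (m_o M + 1) (\<lambda>i. if i = 0 then 1 else if i = 1 then 2 / a_coef Pr 1 else 0)"

definition b_chi :: "real \<Rightarrow> real" where
  "b_chi chi = 2 * chi / (2 - chi) * (2 * pi) powr (- 1 / 2)"

end

theory Submission
  imports Defs "HOL-Probability.Distributions" "Jordan_Normal_Form.Determinant"
begin

text \<open>
  For even \<open>M\<close> both blocks have the same size and \<open>E\<close> is the identity. Orthogonality of \<open>R\<close>
  gives \<open>R_even\<^sup>T R_even = 1/2\<close>, and the eigenvalue equation gives \<open>M0 R_odd = R_even Lp\<close>. Pairing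
  the homogeneous system with \<open>z = (w, R_even v)\<close> therefore yields \<open>b z\<^sup>T S z = v\<^sup>T Lp v / 2 \<ge> 0\<close>,
  where \<open>S\<close> is the scaled half-space matrix. Up to an invertible diagonal scaling, its quadratic
  form is the integral of \<open>\<xi> p(\<xi>)\<^sup>2 exp (-\<xi>\<^sup>2/2)\<close> over the negative half-line, with \<open>p\<close> a
  combination of the linearly independent even Hermite polynomials. Hence it is negative
  definite, so \<open>z = 0\<close> and then \<open>w = 0\<close>, \<open>v = 0\<close>: the square system is injective, so uniquely
  solvable.
\<close>

section \<open>Gaussian-weighted integrals of polynomials\<close>

lemma integrable_poly_gauss: "integrable lborel (\<lambda>x::real. poly p x * exp (- x\<^sup>2 / 2))"
proof -
  \<comment> \<open>The moments of the standard normal density are integrable; the factor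
    \<open>sqrt (2 * pi)\<close> cancels its normalization.\<close>
  have "integrable lborel (\<lambda>x::real. x ^ k * exp (- x\<^sup>2 / 2))" for k
    using integrable_mult_right[OF integrable_std_normal_moment[of k], of "sqrt (2 * pi)"]
    by (simp add: normal_density_def mult_ac)
  then have "integrable lborel (\<lambda>x. \<Sum>k\<le>degree p. coeff p k * (x ^ k * exp (- x\<^sup>2 / 2)))"
    by (intro Bochner_Integration.integrable_sum integrable_mult_right)
  then show ?thesis
    by (simp add: poly_altdef sum_distrib_right mult.assoc)
qed

text \<open>A vanishing integral of a nonnegative integrand would force \<open>p\<close> to be zero
  almost everywhere on \<open>S\<close>. The roots of \<open>p\<close> form a finite, hence null,
  set, so \<open>S\<close> itself would be null. It serves the Hermite norms with
  \<open>S = UNIV\<close> and the half-space form with \<open>S = {..0}\<close>.\<close>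

lemma poly_gauss_integral_pos:
  fixes p :: "real poly"
  assumes "p \<noteq> 0" and S: "S \<in> sets lborel" "emeasure lborel S \<noteq> 0"
    and nn: "\<And>x. x \<in> S \<Longrightarrow> 0 \<le> poly p x"
  shows "0 < (LBINT x:S. poly p x * exp (- x\<^sup>2 / 2))"
proof -
  let ?f = "\<lambda>x::real. indicator S x *\<^sub>R (poly p x * exp (- x\<^sup>2 / 2))"
  have int: "integrable lborel ?f"
    by (rule integrable_mult_indicator[OF S(1) integrable_poly_gauss])
  have ge: "AE x in lborel. 0 \<le> ?f x"
    using nn by (auto simp: indicator_def)
  have "integral\<^sup>L lborel ?f \<noteq> 0"
  proof
    assume "integral\<^sup>L lborel ?f = 0"
    then have "AE x in lborel. ?f x = 0"
      using integral_nonneg_eq_0_iff_AE[OF int ge] by simp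
    moreover have "AE x in lborel. x \<notin> {x. poly p x = 0}"
      using poly_roots_finite[OF \<open>p \<noteq> 0\<close>]
      by (intro AE_not_in null_setsI emeasure_lborel_countable countable_finite)
        (auto intro: countable_finite borel_closed finite_imp_closed)
    ultimately have "AE x in lborel. x \<notin> S"
      by eventually_elim (auto simp: indicator_def split: if_splits)
    then show False
      using S AE_iff_measurable[OF S(1), of "\<lambda>x. x \<notin> S"] by auto
  qed
  moreover have "0 \<le> integral\<^sup>L lborel ?f"
    by (rule integral_nonneg_AE[OF ge])
  ultimately show ?thesis
    unfolding set_lebesgue_integral_def by simp
qed

text \<open>Lebesgue measure is the image of the product measure under the map from coordinates to
  vectors, so Fubini splits the integral. This reduces norms on three-dimensional space to
  one-dimensional integrals.\<close>

lemma integral_lborel_prod: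
  fixes f :: "'a::euclidean_space \<Rightarrow> real \<Rightarrow> real"
  assumes int: "\<And>b. b \<in> Basis \<Longrightarrow> integrable lborel (f b)"
  shows "(\<integral>x. (\<Prod>b\<in>Basis. f b (inner x b)) \<partial>lborel) = (\<Prod>b\<in>Basis. integral\<^sup>L lborel (f b))"
proof -
  interpret product_sigma_finite "\<lambda>_::'a. lborel :: real measure" ..
  have [measurable]: "f b \<in> borel_measurable borel" if "b \<in> Basis" for b
    using borel_measurable_integrable[OF int[OF that]] by simp
  have "(\<integral>x. (\<Prod>b\<in>Basis. f b (inner x b)) \<partial>lborel) =
      (\<integral>y. (\<Prod>b\<in>Basis. f b (inner (\<Sum>b\<in>Basis. y b *\<^sub>R b) b)) \<partial>(\<Pi>\<^sub>M b\<in>Basis. lborel))"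
    by (subst lborel_eq, subst integral_distr) auto
  also have "\<dots> = (\<integral>y. (\<Prod>b\<in>Basis. f b (y b)) \<partial>(\<Pi>\<^sub>M b\<in>Basis. lborel))"
    by (intro Bochner_Integration.integral_cong refl prod.cong) simp
  also have "\<dots> = (\<Prod>b\<in>Basis. integral\<^sup>L lborel (f b))"
    by (rule product_integral_prod) (auto intro: int)
  finally show ?thesis .
qed

section \<open>Hermite polynomials: positive norms and the half-line form\<close>

lemma He_monic: "degree (He n) = n \<and> coeff (He n) n = 1"
proof (induction n rule: He.induct)
  case (3 n)
  have "degree ([:0, 1:] * He (Suc n)) = Suc (Suc n)"
    using 3 by (subst degree_mult_eq) auto
  moreover have "degree (Polynomial.smult (real (Suc n)) (He n)) < Suc (Suc n)"
    using 3 by simp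
  moreover have "coeff (He n) (Suc (Suc n)) = 0"
    using 3 by (intro coeff_eq_0) simp
  ultimately show ?case
    using 3 degree_add_eq_left[of "- Polynomial.smult (real (Suc n)) (He n)" "[:0, 1:] * He (Suc n)"]
    by auto
qed auto

text \<open>Both \<open>He_multi\<close> and the Gaussian weight factor over the coordinates, so the
  squared norm is a positive constant times a product of one-dimensional integrals of squares of
  nonzero polynomials.\<close>

lemma inner_omega_He_pos: "0 < inner_omega (He_multi \<alpha>) (He_multi \<alpha>)"
proof -
  \<comment> \<open>The factors are indexed by basis vectors, as \<open>integral_lborel_prod\<close>
    expects; \<open>axis_index\<close> recovers the coordinate.\<close>
  let ?p = "\<lambda>b::real^3. He (vec_nth \<alpha> (axis_index b)) * He (vec_nth \<alpha> (axis_index b))"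
  let ?f = "\<lambda>b t. poly (?p b) t * exp (- t\<^sup>2 / 2)"
  have B: "(Basis :: (real^3) set) = (\<lambda>i. axis i 1) ` UNIV"
    by (auto simp: Basis_vec_def)
  have inj: "inj (\<lambda>i. axis i (1::real) :: real^3)"
    by (auto simp: inj_on_def axis_eq_axis)
  have "He_multi \<alpha> \<xi> * He_multi \<alpha> \<xi> * omega_bar \<xi> =
      (2 * pi) powr (- 3 / 2) * (\<Prod>b\<in>Basis. ?f b (inner \<xi> b))" for \<xi>
  proof -
    have "exp (- (norm \<xi>)\<^sup>2 / 2) = (\<Prod>i\<in>UNIV. exp (- (vec_nth \<xi> i)\<^sup>2 / 2))"
      by (simp add: norm_vec_def L2_set_def sum_nonneg exp_sum[symmetric] sum_negf sum_divide_distrib)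
    then show ?thesis
      by (simp add: B prod.reindex[OF inj] He_multi_def omega_bar_def prod.distrib inner_axis mult_ac)
  qed
  then have "inner_omega (He_multi \<alpha>) (He_multi \<alpha>) =
      (2 * pi) powr (- 3 / 2) * (\<Prod>b\<in>Basis. integral\<^sup>L lborel (?f b))"
    by (simp only: inner_omega_def integral_mult_right_zero
      integral_lborel_prod[of ?f, OF integrable_poly_gauss])
  moreover have "0 < integral\<^sup>L lborel (?f b)" for b
  proof -
    have "He (vec_nth \<alpha> (axis_index b)) \<noteq> 0"
      using He_monic by (metis coeff_0 zero_neq_one)
    then show ?thesis
      using poly_gauss_integral_pos[of "?p b" UNIV] by (simp add: set_lebesgue_integral_def)
  qed
  ultimately show ?thesis
    by (simp add: prod_pos)
qed

text \<open>The summands have distinct degrees. At the largest index \<open>m\<close> with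
  \<open>c m\<close> nonzero, the coefficient of degree \<open>2 * m\<close> is exactly
  \<open>c m\<close>, because the polynomials are monic and all later terms vanish.\<close>

lemma He_even_combination_nonzero:
  assumes "k < N" and "c k \<noteq> 0"
  shows "(\<Sum>i<N. Polynomial.smult (c i) (He (2 * i))) \<noteq> 0"
proof -
  define m where "m = Max {i. i < N \<and> c i \<noteq> 0}"
  have m: "m < N" "c m \<noteq> 0" and m_max: "\<And>i. i < N \<Longrightarrow> m < i \<Longrightarrow> c i = 0"
  proof -
    have fin: "finite {i. i < N \<and> c i \<noteq> 0}" by simp
    have "m \<in> {i. i < N \<and> c i \<noteq> 0}"
      unfolding m_def using assms by (intro Max_in) auto
    then show "m < N" "c m \<noteq> 0" by auto
    show "c i = 0" if "i < N" "m < i" for i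
      using Max_ge[OF fin, of i] that unfolding m_def[symmetric] by auto
  qed
  have "coeff (\<Sum>i<N. Polynomial.smult (c i) (He (2 * i))) (2 * m) =
      (\<Sum>i<N. if i = m then c m else 0)"
    unfolding coeff_sum
  proof (rule sum.cong)
    fix i assume "i \<in> {..<N}"
    then show "coeff (Polynomial.smult (c i) (He (2 * i))) (2 * m) = (if i = m then c m else 0)"
      using He_monic[of "2 * i"] m_max[of i] by (cases i m rule: linorder_cases) (auto simp: coeff_eq_0)
  qed simp
  then have "coeff (\<Sum>i<N. Polynomial.smult (c i) (He (2 * i))) (2 * m) = c m"
    using m(1) by simp
  with m(2) show ?thesis by (metis coeff_0)
qed

text \<open>With \<open>p\<close> the combination of even Hermite polynomials with coefficients
  \<open>c\<close>, the double sum is the integral of \<open>x * p(x)^2 * exp (- x^2 / 2)\<close>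
  over the negative half-line, where \<open>x\<close> is negative except at the endpoint.\<close>

lemma S_half_form_neg:
  assumes "k < N" and "c k \<noteq> 0"
  shows "(\<Sum>i<N. \<Sum>j<N. c i * c j * S_half (2 * i) (2 * j)) < 0"
proof -
  let ?p = "\<Sum>i<N. Polynomial.smult (c i) (He (2 * i))"
  let ?g = "\<lambda>i j x. x * poly (He (2 * i)) x * poly (He (2 * j)) x * exp (- x\<^sup>2 / 2)"
  let ?h = "\<lambda>i j x. indicator {..0} x *\<^sub>R ?g i j x"
  have int: "integrable lborel (?h i j)" for i j
    using integrable_poly_gauss[of "[:0, 1:] * He (2 * i) * He (2 * j)"]
    by (intro integrable_mult_indicator) (auto simp: mult.assoc)
  have lin: "(\<Sum>i<N. \<Sum>j<N. c i * c j * integral\<^sup>L lborel (h i j)) =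
      (LBINT x. \<Sum>i<N. \<Sum>j<N. c i * c j * h i j x)"
    if "\<And>i j. integrable lborel (h i j)" for h :: "nat \<Rightarrow> nat \<Rightarrow> real \<Rightarrow> real"
    using that by (simp add: Bochner_Integration.integral_sum)
  have "(\<Sum>i<N. \<Sum>j<N. c i * c j * S_half (2 * i) (2 * j)) =
      (LBINT x. \<Sum>i<N. \<Sum>j<N. c i * c j * ?h i j x)"
    unfolding S_half_def set_lebesgue_integral_def by (rule lin[OF int])
  \<comment> \<open>The sign is absorbed into the factor \<open>[:0, -1:]\<close>, that is -x,
    giving a polynomial that is nonnegative on the half-line, as
    \<open>poly_gauss_integral_pos\<close> requires.\<close>
  also have "\<dots> = (LBINT x:{..0}. - (poly ([:0, -1:] * ?p * ?p) x * exp (- x\<^sup>2 / 2)))"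
    unfolding set_lebesgue_integral_def
    by (rule Bochner_Integration.integral_cong)
      (simp_all add: poly_sum sum_product sum_distrib_left sum_distrib_right mult_ac
        sum_negf)
  also have "\<dots> = - (LBINT x:{..0}. poly ([:0, -1:] * ?p * ?p) x * exp (- x\<^sup>2 / 2))"
    by (simp add: set_lebesgue_integral_def)
  also have "\<dots> < 0"
  proof -
    have "?p \<noteq> 0" using He_even_combination_nonzero[of k N c] assms by simp
    moreover have "emeasure lborel {..0::real} \<noteq> 0"
    proof
      assume "emeasure lborel {..0::real} = 0"
      then have "emeasure lborel {-1..0::real} \<le> 0"
        using emeasure_mono[of "{-1..0::real}" "{..0}" lborel] by auto
      then show False by simp
    qed
    ultimately have "0 < (LBINT x:{..0}. poly ([:0, -1:] * ?p * ?p) x * exp (- x\<^sup>2 / 2))"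
      by (intro poly_gauss_integral_pos) (auto simp: mult_nonneg_nonneg mult_nonpos_nonneg mult.assoc)
    then show ?thesis by simp
  qed
  finally show ?thesis .
qed

section \<open>Linear algebra: square systems and block-diagonal matrices\<close>

lemma smult_mat_mult_vec:
  fixes A :: "'a::comm_semiring_0 mat"
  assumes "A \<in> carrier_mat m n" and "v \<in> carrier_vec n"
  shows "(k \<cdot>\<^sub>m A) *\<^sub>v v = k \<cdot>\<^sub>v (A *\<^sub>v v)"
  using assms by (intro eq_vecI) (auto simp: scalar_prod_def sum_distrib_left mult.assoc)

lemma ex1_solution_of_injective_mat:
  fixes A :: "'a::field mat"
  assumes A: "A \<in> carrier_mat n n"
    and inj: "\<And>x. x \<in> carrier_vec n \<Longrightarrow> A *\<^sub>v x = 0\<^sub>v n \<Longrightarrow> x = 0\<^sub>v n"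
    and f: "f \<in> carrier_vec n"
  shows "\<exists>!x. x \<in> carrier_vec n \<and> A *\<^sub>v x = f"
proof -
  have "Determinant.det A \<noteq> 0"
    using det_0_iff_vec_prod_zero_field[OF A] inj by blast
  \<comment> \<open>The argument \<open>()\<close> merely fills the extension field of the ring
    record.\<close>
  from det_non_zero_imp_unit[OF A this, of "()"]
  obtain B where B: "B \<in> carrier_mat n n" "B * A = 1\<^sub>m n" "A * B = 1\<^sub>m n"
    unfolding Units_def ring_mat_def by auto
  show ?thesis
  proof (rule ex1I)
    show "B *\<^sub>v f \<in> carrier_vec n \<and> A *\<^sub>v (B *\<^sub>v f) = f"
      using A B f assoc_mult_mat_vec[OF A B(1) f] by auto
    show "x = B *\<^sub>v f" if "x \<in> carrier_vec n \<and> A *\<^sub>v x = f" for x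
      using that A B assoc_mult_mat_vec[OF B(1) A, of x] by auto
  qed
qed

text \<open>The unknowns are stacked as a scalar followed by a vector. A leading block 1 keeps the
  scalar, so such matrices build the stacked vectors of the system; a leading block 0 erases
  it.\<close>

lemma mult_diag_block_vCons:
  fixes B :: "'a::comm_ring_1 mat"
  assumes A: "A \<in> carrier_mat 1 1" and B: "B \<in> carrier_mat m n" and v: "v \<in> carrier_vec n"
  shows "diag_block_mat [A, B] *\<^sub>v vCons w v = vCons (A $$ (0, 0) * w) (B *\<^sub>v v)"
proof -
  have split: "vCons c u = vec 1 (\<lambda>_. c) @\<^sub>v u" for c :: 'a and u
    by (rule eq_vecI) (auto simp: vec_index_vCons)
  have D: "diag_block_mat [A, B] = four_block_mat A (0\<^sub>m 1 n) (0\<^sub>m m 1) B"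
    using A B by (auto simp: Let_def intro!: eq_matI)
  have "A *\<^sub>v vec 1 (\<lambda>_. w) = vec 1 (\<lambda>_. A $$ (0, 0) * w)"
    using A by (intro eq_vecI) (auto simp: scalar_prod_def)
  moreover have "0\<^sub>m m 1 *\<^sub>v vec 1 (\<lambda>_. w) = 0\<^sub>v m" "0\<^sub>m 1 n *\<^sub>v v = 0\<^sub>v 1"
    using v by (auto simp: scalar_prod_def intro!: eq_vecI)
  ultimately show ?thesis
    unfolding split D using A B v
    by (subst four_block_mat_mult_vec[of A 1 1 "0\<^sub>m 1 n" n "0\<^sub>m m 1" m]) auto
qed

section \<open>Block identities of the diagonalization, and the abstract boundary system\<close>

lemma four_block_mat_eqD:
  assumes "four_block_mat A B C D = four_block_mat A' B' C' D'"
    and "A \<in> carrier_mat m n" "A' \<in> carrier_mat m n"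
    and "D \<in> carrier_mat k l" "D' \<in> carrier_mat k l"
    and "B \<in> carrier_mat m l" "B' \<in> carrier_mat m l"
  shows "A = A'" and "B = B'"
proof -
  have *: "four_block_mat A B C D $$ (i, j) = four_block_mat A' B' C' D' $$ (i, j)" for i j
    using assms(1) by simp
  show "A = A'"
  proof (rule eq_matI)
    fix i j assume "i < dim_row A'" "j < dim_col A'"
    then show "A $$ (i, j) = A' $$ (i, j)" using *[of i j] assms(2-) by auto
  qed (use assms in auto)
  show "B = B'"
  proof (rule eq_matI)
    fix i j assume "i < dim_row B'" "j < dim_col B'"
    then show "B $$ (i, j) = B' $$ (i, j)" using *[of i "n + j"] assms(2-) by auto
  qed (use assms in auto)
qed

text \<open>For equal block sizes \<open>R_zero\<close> has no columns, so \<open>R\<close> has the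
  blocks \<open>R_even\<close>, \<open>R_even\<close>, \<open>R_odd\<close>, \<open>- R_odd\<close>.
  The upper blocks of the orthogonality relation say that the two Gram matrices sum to the identity
  and are equal; the upper left block of the eigenvalue equation is the second claim.\<close>

lemma diagonalization_square_blocks:
  assumes eq: "m_e M = n" "m_o M = n"
    and diag: "diagonalization M Pr R_even R_zero R_odd Lp"
  shows "transpose_mat R_even * R_even = (1 / 2) \<cdot>\<^sub>m 1\<^sub>m n"
    and "M0 M Pr * R_odd = R_even * Lp"
proof -
  from diag eq have c: "R_even \<in> carrier_mat n n" "R_zero \<in> carrier_mat n 0"
      "R_odd \<in> carrier_mat n n" "Lp \<in> carrier_mat n n"
    and orth: "transpose_mat (R_block M R_even R_zero R_odd) * R_block M R_even R_zero R_odd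
      = 1\<^sub>m (n + n)"
    and eig: "M_sym M Pr * R_block M R_even R_zero R_odd
      = R_block M R_even R_zero R_odd * Lambda_block M Lp"
    by (auto simp: diagonalization_def Let_def)
  have K: "M0 M Pr \<in> carrier_mat n n" by (simp add: M0_def eq)
  have R: "R_block M R_even R_zero R_odd = four_block_mat R_even R_even R_odd (- R_odd)"
    using c by (auto simp: R_block_def append_cols_def eq intro!: eq_matI)
  have L: "Lambda_block M Lp = four_block_mat Lp (0\<^sub>m n n) (0\<^sub>m n n) (- Lp)"
    using c by (auto simp: Lambda_block_def Let_def eq intro!: eq_matI)
  let ?X = "transpose_mat R_even * R_even" and ?Y = "transpose_mat R_odd * R_odd"
  have X: "?X \<in> carrier_mat n n" and Y: "?Y \<in> carrier_mat n n" using c by auto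
  have "four_block_mat (?X + ?Y) (?X + transpose_mat R_odd * (- R_odd))
      (?X + transpose_mat (- R_odd) * R_odd) (?X + transpose_mat (- R_odd) * (- R_odd))
      = four_block_mat (1\<^sub>m n) (0\<^sub>m n n) (0\<^sub>m n n) (1\<^sub>m n)"
    using orth c unfolding R four_block_one_mat
    by (subst (asm) transpose_four_block_mat, (auto)[4])
       (subst (asm) mult_four_block_mat, auto)
  note blocks = four_block_mat_eqD[OF this, of n n n n]
  \<comment> \<open>The upper left block gives the sum, the upper right one the difference.\<close>
  have sum: "?X + ?Y = 1\<^sub>m n" and diff: "?X - ?Y = 0\<^sub>m n n"
    using blocks c X Y by (auto simp: minus_add_uminus_mat[OF X Y])
  show "?X = (1 / 2) \<cdot>\<^sub>m 1\<^sub>m n"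
  proof (rule eq_matI)
    fix i j assume "i < dim_row ((1 / 2) \<cdot>\<^sub>m 1\<^sub>m n)" "j < dim_col ((1 / 2) \<cdot>\<^sub>m 1\<^sub>m n)"
    then have ij: "i < n" "j < n" by auto
    have "?X $$ (i, j) + ?Y $$ (i, j) = 1\<^sub>m n $$ (i, j)"
      using arg_cong[OF sum, of "\<lambda>A. A $$ (i, j)"] ij by (metis Y index_add_mat(1) carrier_matD)
    moreover have "?X $$ (i, j) - ?Y $$ (i, j) = 0"
      using arg_cong[OF diff, of "\<lambda>A. A $$ (i, j)"] ij Y
      by (metis index_minus_mat(1) index_zero_mat(1) carrier_matD)
    ultimately show "?X $$ (i, j) = ((1 / 2) \<cdot>\<^sub>m 1\<^sub>m n) $$ (i, j)"
      using ij by simp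
  qed (use c in auto)
  have "four_block_mat (0\<^sub>m n n * R_even + M0 M Pr * R_odd) (0\<^sub>m n n * R_even + M0 M Pr * (- R_odd))
      (transpose_mat (M0 M Pr) * R_even + 0\<^sub>m n n * R_odd)
      (transpose_mat (M0 M Pr) * R_even + 0\<^sub>m n n * (- R_odd))
    = four_block_mat (R_even * Lp + R_even * 0\<^sub>m n n) (R_even * 0\<^sub>m n n + R_even * (- Lp))
      (R_odd * Lp + (- R_odd) * 0\<^sub>m n n) (R_odd * 0\<^sub>m n n + (- R_odd) * (- Lp))"
    using eig c K unfolding R L M_sym_def eq
    by (subst (asm) mult_four_block_mat, (auto)[8])
       (subst (asm) mult_four_block_mat, (auto)[9])
  from four_block_mat_eqD(1)[OF this, of n n n n] c K
  show "M0 M Pr * R_odd = R_even * Lp" by auto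
qed

text \<open>The pair of unknowns is packed into one vector \<open>x\<close> so that the criterion
  for square matrices applies. Since \<open>vCons\<close> is injective and \<open>x\<close> has
  positive dimension, the quantifier over \<open>w\<close> and \<open>v\<close> ranges over exactly
  one decomposition.\<close>

lemma boundary_system_ex1:
  fixes S K Re Ro L :: "real mat"
  assumes S: "S \<in> carrier_mat (Suc n) (Suc n)"
    and S_neg: "\<And>z. z \<in> carrier_vec (Suc n) \<Longrightarrow> z \<noteq> 0\<^sub>v (Suc n) \<Longrightarrow> scalar_prod z (S *\<^sub>v z) < 0"
    and K: "K \<in> carrier_mat n n" and Re: "Re \<in> carrier_mat n n"
    and Ro: "Ro \<in> carrier_mat n n" and L: "L \<in> carrier_mat n n"
    and L_diag: "diagonal_mat L" and L_nonneg: "\<And>i. i < n \<Longrightarrow> 0 \<le> L $$ (i, i)"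
    and gram: "transpose_mat Re * Re = c \<cdot>\<^sub>m 1\<^sub>m n" and c: "0 < c"
    and KRo: "K * Ro = Re * L"
    and f: "f \<in> carrier_vec (Suc n)"
  shows "\<exists>!x. x \<in> carrier_vec (Suc n) \<and> (\<forall>w v. x = vCons w v \<longrightarrow>
    f + diag_block_mat [0\<^sub>m 1 1, K] *\<^sub>v vCons w (Ro *\<^sub>v v) = S *\<^sub>v vCons w (Re *\<^sub>v v))"
proof -
  let ?P = "diag_block_mat [1\<^sub>m 1, Re]" and ?Q = "diag_block_mat [1\<^sub>m 1, Ro]"
  let ?D = "diag_block_mat [0\<^sub>m 1 1, K]"
  \<comment> \<open>\<open>?P\<close> and \<open>?Q\<close> send the unknown to the stacked vectors
    with tails \<open>Re *\<^sub>v v\<close> and \<open>Ro *\<^sub>v v\<close>; collecting the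
    unknowns on one side turns the system into \<open>A *\<^sub>v x = f\<close>.\<close>
  define A where "A = S * ?P - ?D * ?Q"
  have carr: "?P \<in> carrier_mat (Suc n) (Suc n)" "?Q \<in> carrier_mat (Suc n) (Suc n)"
      "?D \<in> carrier_mat (Suc n) (Suc n)"
    using Re Ro K by (auto simp: Let_def)
  then have A: "A \<in> carrier_mat (Suc n) (Suc n)"
    unfolding A_def using S by (intro minus_carrier_mat mult_carrier_mat)
  have A_vCons: "A *\<^sub>v vCons w v = S *\<^sub>v vCons w (Re *\<^sub>v v) - ?D *\<^sub>v vCons w (Ro *\<^sub>v v)"
    if v: "v \<in> carrier_vec n" for w v
  proof -
    have x: "vCons w v \<in> carrier_vec (Suc n)" using v by simp
    have P: "?P *\<^sub>v vCons w v = vCons w (Re *\<^sub>v v)"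
      using mult_diag_block_vCons[OF _ Re v, of "1\<^sub>m 1" w] by simp
    have Q: "?Q *\<^sub>v vCons w v = vCons w (Ro *\<^sub>v v)"
      using mult_diag_block_vCons[OF _ Ro v, of "1\<^sub>m 1" w] by simp
    have "A *\<^sub>v vCons w v = (S * ?P) *\<^sub>v vCons w v - (?D * ?Q) *\<^sub>v vCons w v"
      unfolding A_def
      by (rule minus_mult_distrib_mat_vec[OF mult_carrier_mat[OF S carr(1)]
          mult_carrier_mat[OF carr(3,2)] x])
    also have "\<dots> = S *\<^sub>v (?P *\<^sub>v vCons w v) - ?D *\<^sub>v (?Q *\<^sub>v vCons w v)"
      using assoc_mult_mat_vec[OF S carr(1) x] assoc_mult_mat_vec[OF carr(3,2) x] by simp
    finally show ?thesis unfolding P Q .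
  qed
  have "\<exists>!x. x \<in> carrier_vec (Suc n) \<and> A *\<^sub>v x = f"
  proof (rule ex1_solution_of_injective_mat[OF A _ f])
    fix x assume x: "x \<in> carrier_vec (Suc n)" and Ax: "A *\<^sub>v x = 0\<^sub>v (Suc n)"
    obtain w v where xv: "x = vCons w v" and v: "v \<in> carrier_vec n"
      using x by (cases x) auto
    define z where "z = vCons w (Re *\<^sub>v v)"
    have Rev: "Re *\<^sub>v v \<in> carrier_vec n" and Rov: "Ro *\<^sub>v v \<in> carrier_vec n"
      and Lv: "L *\<^sub>v v \<in> carrier_vec n"
      using Re Ro L v by auto
    have z: "z \<in> carrier_vec (Suc n)" using Rev by (simp add: z_def)
    have D: "?D *\<^sub>v vCons w (Ro *\<^sub>v v) = vCons 0 (K *\<^sub>v (Ro *\<^sub>v v))"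
      using mult_diag_block_vCons[OF _ K Rov, of "0\<^sub>m 1 1" w] by simp
    have "S *\<^sub>v z - vCons 0 (K *\<^sub>v (Ro *\<^sub>v v)) = 0\<^sub>v (Suc n)"
      using Ax A_vCons[OF v, of w] unfolding xv z_def D by simp
    moreover have "S *\<^sub>v z \<in> carrier_vec (Suc n)"
      using S z by auto
    moreover have "vCons 0 (K *\<^sub>v (Ro *\<^sub>v v)) \<in> carrier_vec (Suc n)"
      using K Rov by auto
    ultimately have Sz: "S *\<^sub>v z = vCons 0 (K *\<^sub>v (Ro *\<^sub>v v))"
      using S by (auto simp: vec_eq_iff)
    \<comment> \<open>The Gram identity makes \<open>Re\<close> an isometry up to the factor
      \<open>c\<close>. This evaluates the quadratic form below and later gives injectivity of
      \<open>Re\<close>.\<close>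
    have RtR: "scalar_prod (Re *\<^sub>v v) (Re *\<^sub>v y) = c * scalar_prod v y"
      if y: "y \<in> carrier_vec n" for y
    proof -
      have "scalar_prod (Re *\<^sub>v v) (Re *\<^sub>v y) = scalar_prod v (transpose_mat Re *\<^sub>v (Re *\<^sub>v y))"
        using transpose_vec_mult_scalar[of "transpose_mat Re" n n "Re *\<^sub>v y" v] Re v y
        by simp
      also have "\<dots> = scalar_prod v ((c \<cdot>\<^sub>m 1\<^sub>m n) *\<^sub>v y)"
        using Re y by (simp add: assoc_mult_mat_vec[symmetric] gram)
      also have "\<dots> = c * scalar_prod v y"
        using v y by (simp add: smult_mat_mult_vec[of _ n n])
      finally show ?thesis .
    qed
    \<comment> \<open>The first entry of \<open>S *\<^sub>v z\<close> is zero, so \<open>w\<close>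
      drops out of the pairing.\<close>
    have "scalar_prod z (S *\<^sub>v z) = scalar_prod (Re *\<^sub>v v) (K *\<^sub>v (Ro *\<^sub>v v))"
      by (subst Sz) (simp add: z_def)
    also have "K *\<^sub>v (Ro *\<^sub>v v) = Re *\<^sub>v (L *\<^sub>v v)"
      using assoc_mult_mat_vec[OF K Ro v] assoc_mult_mat_vec[OF Re L v] KRo by simp
    also have "scalar_prod (Re *\<^sub>v v) (Re *\<^sub>v (L *\<^sub>v v)) = c * scalar_prod v (L *\<^sub>v v)"
      by (rule RtR[OF Lv])
    also have "scalar_prod v (L *\<^sub>v v) = (\<Sum>i<n. L $$ (i, i) * (v $ i)\<^sup>2)"
    proof -
      have "(L *\<^sub>v v) $ i = L $$ (i, i) * v $ i" if "i < n" for i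
      proof -
        have "(L *\<^sub>v v) $ i = (\<Sum>j = 0..<n. L $$ (i, j) * v $ j)"
          using that L v by (auto simp: scalar_prod_def)
        also have "\<dots> = (\<Sum>j = 0..<n. if j = i then L $$ (i, i) * v $ i else 0)"
          using that L L_diag by (intro sum.cong) (auto simp: diagonal_mat_def)
        finally show ?thesis using that by simp
      qed
      then show ?thesis using L v
        by (auto simp: scalar_prod_def power2_eq_square atLeast0LessThan intro!: sum.cong)
    qed
    finally have "0 \<le> scalar_prod z (S *\<^sub>v z)"
      using c L_nonneg by (auto intro!: mult_nonneg_nonneg sum_nonneg)
    with S_neg[OF z] have "z = 0\<^sub>v (Suc n)" by force
    then have w: "w = 0" and Rev0: "Re *\<^sub>v v = 0\<^sub>v n"
      by (auto simp: z_def zero_vec_Suc)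
    \<comment> \<open>Vanishing of \<open>z\<close> controls only the image of \<open>v\<close>
      under \<open>Re\<close>; the isometry property transfers this to \<open>v\<close>
      itself.\<close>
    have "c * scalar_prod v v = 0" using RtR[OF v] Rev0 by simp
    then have "v = 0\<^sub>v n"
      using c v by (simp add: scalar_prod_def vec_eq_iff sum_nonneg_eq_0_iff)
    with w show "x = 0\<^sub>v (Suc n)" by (simp add: xv zero_vec_Suc)
  qed
  moreover have "A *\<^sub>v x = f \<longleftrightarrow> (\<forall>w v. x = vCons w v \<longrightarrow>
    f + ?D *\<^sub>v vCons w (Ro *\<^sub>v v) = S *\<^sub>v vCons w (Re *\<^sub>v v))"
    if x: "x \<in> carrier_vec (Suc n)" for x
  proof -
    obtain w v where xv: "x = vCons w v" and v: "v \<in> carrier_vec n"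
      using x by (cases x) auto
    have "?D *\<^sub>v vCons w (Ro *\<^sub>v v) \<in> carrier_vec (Suc n)"
      "S *\<^sub>v vCons w (Re *\<^sub>v v) \<in> carrier_vec (Suc n)"
      using carr(3) S v Re Ro mult_mat_vec_carrier[of _ "Suc n" "Suc n"]
        mult_mat_vec_carrier[of _ n n v] by (simp_all del: diag_block_mat.simps)
    moreover have "q - p = f \<longleftrightarrow> f + p = q"
      if "p \<in> carrier_vec (Suc n)" "q \<in> carrier_vec (Suc n)" for p q
      using that f by (auto simp: vec_eq_iff algebra_simps)
    ultimately have "S *\<^sub>v vCons w (Re *\<^sub>v v) - ?D *\<^sub>v vCons w (Ro *\<^sub>v v) = f \<longleftrightarrow>
        f + ?D *\<^sub>v vCons w (Ro *\<^sub>v v) = S *\<^sub>v vCons w (Re *\<^sub>v v)"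
      by blast
    then show ?thesis unfolding xv A_vCons[OF v] by (simp del: diag_block_mat.simps)
  qed
  ultimately show ?thesis by (metis (no_types, lifting))
qed

section \<open>Negative definiteness of \<open>S_tilde\<close> and the concrete boundary
  system\<close>

lemma S_mat_form_neg:
  assumes y: "y \<in> carrier_vec (Suc (m_e M))" "y \<noteq> 0\<^sub>v (Suc (m_e M))"
  shows "scalar_prod y (S_mat M *\<^sub>v y) < 0"
proof -
  obtain k where k: "k < Suc (m_e M)" "y $ k \<noteq> 0"
    using y by (auto simp: vec_eq_iff)
  have "scalar_prod y (S_mat M *\<^sub>v y) =
      (\<Sum>i<Suc (m_e M). \<Sum>j<Suc (m_e M). y $ i * y $ j * S_half (2 * i) (2 * j))"
    using y(1) by (auto simp: S_mat_def scalar_prod_def sum_distrib_left atLeast0LessThan mult_ac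
        simp del: sum.lessThan_Suc intro!: sum.cong)
  also have "\<dots> < 0" by (rule S_half_form_neg[where c = "vec_index y", OF k])
  finally show ?thesis .
qed

text \<open>The Prandtl correction is \<open>(4 + Pr) / 5\<close> for \<open>i = 1\<close> and 1
  otherwise, so it is positive, as is the squared norm.\<close>

lemma a_coef_pos:
  assumes "0 < Pr"
  shows "0 < a_coef Pr i"
  unfolding a_coef_def phi_even_def real_sqrt_gt_0_iff
  using assms by (intro mult_pos_pos inner_omega_He_pos) auto

text \<open>\<open>S_tilde\<close> is congruent to \<open>S_mat\<close> through an invertible
  diagonal matrix, and congruence preserves negative definiteness.\<close>

lemma S_tilde_carrier_and_form_neg:
  assumes Pr: "0 < Pr"
  shows "S_tilde M Pr \<in> carrier_mat (Suc (m_e M)) (Suc (m_e M))"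
    and "z \<in> carrier_vec (Suc (m_e M)) \<Longrightarrow> z \<noteq> 0\<^sub>v (Suc (m_e M)) \<Longrightarrow>
      scalar_prod z (S_tilde M Pr *\<^sub>v z) < 0"
proof -
  let ?N = "Suc (m_e M)"
  \<comment> \<open>\<open>L1\<close> starts with \<open>a_coef Pr 1\<close> and sits one row below
    the top, so the diagonal entry in row \<open>i > 0\<close> is \<open>a_coef Pr i\<close> without
    a shift.\<close>
  define d where "d i = (if i = 0 then 1 else a_coef Pr i)" for i
  let ?D = "mat_diag ?N d" and ?B = "mat_diag ?N (\<lambda>i. 1 / d i)"
  have d: "d i \<noteq> 0" for i
    using a_coef_pos[OF Pr, of i] by (simp add: d_def)
  have D: "diag_block_mat [1\<^sub>m 1, L1 M Pr] = ?D"
    by (rule eq_matI) (auto simp: L1_def mat_diag_def d_def Let_def)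
  have DB: "?D * ?B = 1\<^sub>m ?N" "?B * ?D = 1\<^sub>m ?N"
    using d by simp_all
  \<comment> \<open>\<open>mat_inverse\<close> returns \<open>None\<close> only for non-units, so
    exhibiting the inverse \<open>?B\<close> ensures that \<open>the\<close> in
    \<open>S_tilde\<close> receives a genuine value.\<close>
  then have "?D \<in> Units (ring_mat TYPE(real) ?N ())"
    unfolding Units_def ring_mat_def by (auto intro!: bexI[of _ ?B])
  then obtain B where B: "mat_inverse ?D = Some B"
    using mat_inverse(1)[of ?D ?N "()"] by (cases "mat_inverse ?D") auto
  from mat_inverse(2)[OF _ this, of ?N]
  have B_inv: "B * ?D = 1\<^sub>m ?N" and B_carr: "B \<in> carrier_mat ?N ?N" by auto
  \<comment> \<open>A left inverse of \<open>?D\<close> agrees with its right inverse, so the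
    computed inverse is the explicit diagonal one.\<close>
  have "B = B * (?D * ?B)" using DB(1) B_carr by simp
  also have "\<dots> = ?B" using B_inv assoc_mult_mat[OF B_carr mat_diag_dim mat_diag_dim, of d]
      left_mult_one_mat[OF mat_diag_dim, of ?N] by metis
  finally have St: "S_tilde M Pr = ?B * S_mat M * ?B"
    unfolding S_tilde_def D B by (simp add: Let_def)
  have S: "S_mat M \<in> carrier_mat ?N ?N" by (simp add: S_mat_def)
  have B: "?B \<in> carrier_mat ?N ?N" by simp
  show "S_tilde M Pr \<in> carrier_mat ?N ?N" unfolding St using S B by (intro mult_carrier_mat)
  assume z: "z \<in> carrier_vec ?N" "z \<noteq> 0\<^sub>v ?N"
  define y where "y = ?B *\<^sub>v z"
  have y: "y \<in> carrier_vec ?N" unfolding y_def using B z(1) by (rule mult_mat_vec_carrier)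
  have zy: "?D *\<^sub>v y = z"
    unfolding y_def using assoc_mult_mat_vec[of ?D ?N ?N ?B ?N z] DB(1) z(1) by simp
  have "y \<noteq> 0\<^sub>v ?N"
  proof
    assume "y = 0\<^sub>v ?N"
    then have "z = ?D *\<^sub>v 0\<^sub>v ?N" using zy by simp
    also have "\<dots> = 0\<^sub>v ?N" by (rule eq_vecI) (simp_all add: mat_diag_def scalar_prod_def)
    finally have "z = 0\<^sub>v ?N" .
    with z(2) show False ..
  qed
  \<comment> \<open>Symmetry of \<open>?B\<close> lets it move across the scalar product onto
    \<open>z\<close>, producing \<open>y\<close> on both sides.\<close>
  have Bt: "transpose_mat ?B = ?B" by (rule eq_matI) (auto simp: mat_diag_def)
  have Sy: "S_mat M *\<^sub>v y \<in> carrier_vec ?N" using S y by (rule mult_mat_vec_carrier)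
  have "S_tilde M Pr *\<^sub>v z = ?B *\<^sub>v (S_mat M *\<^sub>v y)"
    unfolding St assoc_mult_mat_vec[OF mult_carrier_mat[OF B S] B z(1)] y_def[symmetric]
    by (rule assoc_mult_mat_vec[OF B S y])
  then have "scalar_prod z (S_tilde M Pr *\<^sub>v z) = scalar_prod y (S_mat M *\<^sub>v y)"
    using transpose_vec_mult_scalar[OF B Sy z(1)] Bt by (simp add: y_def)
  also have "\<dots> < 0" by (rule S_mat_form_neg[OF y \<open>y \<noteq> 0\<^sub>v ?N\<close>])
  finally show "scalar_prod z (S_tilde M Pr *\<^sub>v z) < 0" .
qed

theorem theorem4p1:
  fixes M :: nat and chi Pr \<sigma>12 u1W :: real
    and R_even R_zero R_odd Lp :: "real mat"
  assumes "4 \<le> M" and "even M"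
    and "0 < chi" and "chi \<le> 1"
    and "0 < Pr"
    and "diagonalization M Pr R_even R_zero R_odd Lp"
  shows "\<exists>!p :: real \<times> real vec. case p of (u1, v) \<Rightarrow>
    v \<in> carrier_vec (m_o M) \<and>
    \<sigma>12 \<cdot>\<^sub>v r_vec M Pr
      + (E_mat M * diag_block_mat [0\<^sub>m 1 1, M0 M Pr]) *\<^sub>v vCons (u1 - u1W) (R_odd *\<^sub>v v)
    = (b_chi chi \<cdot>\<^sub>m (E_mat M * S_tilde M Pr)) *\<^sub>v vCons (u1 - u1W) (R_even *\<^sub>v v)"
proof -
  obtain k where k: "M = 2 * k" using \<open>even M\<close> by (elim evenE)
  define n where "n = m_o M"
  have mo: "m_o M = n" by (simp add: n_def)
  \<comment> \<open>Parity enters here: for \<open>M = 2 * k\<close> both floors equal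
    \<open>k - 1\<close>.\<close>
  have me: "m_e M = n" using \<open>4 \<le> M\<close> unfolding n_def m_e_def m_o_def k by arith
  have c: "R_even \<in> carrier_mat n n" "R_odd \<in> carrier_mat n n" "Lp \<in> carrier_mat n n"
    and Lp: "diagonal_mat Lp" "\<And>i. i < n \<Longrightarrow> 0 \<le> Lp $$ (i, i)"
    using assms(6) by (auto simp: diagonalization_def me mo less_imp_le)
  have K: "M0 M Pr \<in> carrier_mat n n" by (simp add: M0_def me mo)
  have E: "E_mat M = 1\<^sub>m (Suc n)" by (auto simp: E_mat_def me mo intro!: eq_matI)
  let ?D = "diag_block_mat [0\<^sub>m 1 1, M0 M Pr]"
  let ?S = "b_chi chi \<cdot>\<^sub>m S_tilde M Pr" and ?f = "\<sigma>12 \<cdot>\<^sub>v r_vec M Pr"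
  \<comment> \<open>Since \<open>chi\<close> is at most 1, the denominator \<open>2 - chi\<close> is
    positive; scaling by \<open>b_chi chi\<close> thus keeps the form negative definite.\<close>
  have b: "0 < b_chi chi" using assms(3,4) by (simp add: b_chi_def)
  note St = S_tilde_carrier_and_form_neg[where M = M, OF \<open>0 < Pr\<close>, unfolded me]
  have D: "?D \<in> carrier_mat (Suc n) (Suc n)" using K by (auto simp: Let_def)
  have S_neg: "scalar_prod z (?S *\<^sub>v z) < 0"
    if "z \<in> carrier_vec (Suc n)" "z \<noteq> 0\<^sub>v (Suc n)" for z
  proof -
    have "scalar_prod z (?S *\<^sub>v z) = b_chi chi * scalar_prod z (S_tilde M Pr *\<^sub>v z)"
      using St(1) that(1) by (simp add: smult_mat_mult_vec[of _ "Suc n" "Suc n"])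
    then show ?thesis using St(2)[OF that] b by (simp add: mult_pos_neg)
  qed
  \<comment> \<open>The velocity enters only through the slip \<open>w = u1 - u1W\<close>, so the
    system is solved for \<open>w\<close> first.\<close>
  define Q where "Q w v \<longleftrightarrow>
    ?f + ?D *\<^sub>v vCons w (R_odd *\<^sub>v v) = ?S *\<^sub>v vCons w (R_even *\<^sub>v v)" for w v
  have "\<exists>!x. x \<in> carrier_vec (Suc n) \<and> (\<forall>w v. x = vCons w v \<longrightarrow> Q w v)"
    unfolding Q_def
    using diagonalization_square_blocks[OF me mo assms(6)] St(1) S_neg K c Lp
    by (intro boundary_system_ex1[of ?S n "M0 M Pr" R_even R_odd Lp "1 / 2"])
      (auto simp: r_vec_def mo)
  then obtain x where x: "x \<in> carrier_vec (Suc n)" "\<And>w v. x = vCons w v \<Longrightarrow> Q w v"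
    and unique: "\<And>y. y \<in> carrier_vec (Suc n) \<Longrightarrow> (\<And>w v. y = vCons w v \<Longrightarrow> Q w v) \<Longrightarrow> y = x"
    by blast
  obtain w v where xv: "x = vCons w v" and v: "v \<in> carrier_vec n"
    using x(1) by (cases x) auto
  have "\<exists>!p :: real \<times> real vec. case p of (u1, v) \<Rightarrow> v \<in> carrier_vec n \<and> Q (u1 - u1W) v"
  \<comment> \<open>Adding \<open>u1W\<close> to the slip recovers the velocity; this shift is a
    bijection and carries uniqueness over to the pair.\<close>
  proof (rule ex1I[of _ "(w + u1W, v)"])
    fix p :: "real \<times> real vec"
    assume p: "case p of (u1, v) \<Rightarrow> v \<in> carrier_vec n \<and> Q (u1 - u1W) v"
    obtain u v' where p_eq: "p = (u, v')" by (cases p)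
    have "vCons (u - u1W) v' = x"
      using p unfolding p_eq by (intro unique) auto
    then show "p = (w + u1W, v)" by (auto simp: p_eq xv)
  qed (use x(2) xv v in auto)
  then show ?thesis
    unfolding Q_def E mo left_mult_one_mat[OF D] left_mult_one_mat[OF St(1)] .
qed

end
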